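(* Let $M^m$ be a connected $m$-dimensional CW complex, let $\tau$ be a free cellular involution on $M^m$, and let $q:M^m\to M^m/\tau$ be the quotient map. If $\mathrm{secat}(q)=m$, then the index of $\tau$ on $M^m$ is $m-1$.
   Context: A free involution is a continuous involution without fixed points. The index of $\tau$ on $M^m$ is $\min\{n\in\{0,1,2,\ldots\}: \text{there is a continuous } \mathbb{Z}_2\text{-equivariant map } M^m\to S^n\}$, where $\mathbb{Z}_2$ acts on $M^m$ by $\tau$ and on $S^n$ by the antipodal map. The sectional category $\mathrm{secat}(q)$ of the 2-sheeted covering $q$ is the minimal cardinality of an open cover of $M^m/\tau$ such that over each member $U$ there is a continuous local section $s:U\to M^m$ (i.e. $q\circ s$ is the inclusion of $U$); $\mathrm{secat}(q)=\infty$ if no finite such cover exists. *)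

theory Defs
  imports "HOL-Analysis.Analysis" "HOL-Library.Extended_Nat"
begin

definition unit_disc :: "nat \<Rightarrow> (nat \<Rightarrow> real) topology" where
  "unit_disc n = subtopology (Euclidean_space n) {x. (\<Sum>i<n. (x i)\<^sup>2) \<le> 1}"

definition disc_interior :: "nat \<Rightarrow> (nat \<Rightarrow> real) set" where
  "disc_interior n = {x \<in> topspace (unit_disc n). (\<Sum>i<n. (x i)\<^sup>2) < 1}"

definition disc_boundary :: "nat \<Rightarrow> (nat \<Rightarrow> real) set" where
  "disc_boundary n = {x \<in> topspace (unit_disc n). (\<Sum>i<n. (x i)\<^sup>2) = 1}"

text \<open>A cell structure is a family \<open>E\<close>, where \<open>E n\<close> is the set of open \<open>n\<close>-cells.
  The finite set \<open>F\<close> below expresses closure-finiteness: the boundary of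
  each cell lies in a finite union of cells of smaller dimension.\<close>

definition characteristic_map ::
  "'a topology \<Rightarrow> (nat \<Rightarrow> 'a set set) \<Rightarrow> nat \<Rightarrow> 'a set \<Rightarrow> ((nat \<Rightarrow> real) \<Rightarrow> 'a) \<Rightarrow> bool" where
  "characteristic_map X E n e \<phi> \<longleftrightarrow>
     continuous_map (unit_disc n) X \<phi> \<and>
     homeomorphic_map (subtopology (unit_disc n) (disc_interior n)) (subtopology X e) \<phi> \<and>
     (\<exists>F. finite F \<and> F \<subseteq> (\<Union>k<n. E k) \<and> \<phi> ` disc_boundary n \<subseteq> \<Union>F)"

definition cw_complex :: "'a topology \<Rightarrow> (nat \<Rightarrow> 'a set set) \<Rightarrow> bool" where
  "cw_complex X E \<longleftrightarrow>
     Hausdorff_space X \<and>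
     topspace X = (\<Union>n. \<Union>(E n)) \<and>
     (\<forall>n n' e e'. e \<in> E n \<longrightarrow> e' \<in> E n' \<longrightarrow> (n, e) \<noteq> (n', e') \<longrightarrow> disjnt e e') \<and>
     (\<forall>n. \<forall>e\<in>E n. \<exists>\<phi>. characteristic_map X E n e \<phi>) \<and>
     (\<forall>A. A \<subseteq> topspace X \<longrightarrow>
        (closedin X A \<longleftrightarrow> (\<forall>n. \<forall>e\<in>E n. closedin X (A \<inter> X closure_of e))))"

definition has_cw_dimension :: "(nat \<Rightarrow> 'a set set) \<Rightarrow> nat \<Rightarrow> bool" where
  "has_cw_dimension E m \<longleftrightarrow> E m \<noteq> {} \<and> (\<forall>n>m. E n = {})"

definition skeleton :: "(nat \<Rightarrow> 'a set set) \<Rightarrow> nat \<Rightarrow> 'a set" where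
  "skeleton E n = (\<Union>k\<le>n. \<Union>(E k))"

definition cellular_map ::
  "'a topology \<Rightarrow> (nat \<Rightarrow> 'a set set) \<Rightarrow> 'b topology \<Rightarrow> (nat \<Rightarrow> 'b set set) \<Rightarrow> ('a \<Rightarrow> 'b) \<Rightarrow> bool" where
  "cellular_map X E Y F f \<longleftrightarrow>
     continuous_map X Y f \<and> (\<forall>n. f ` skeleton E n \<subseteq> skeleton F n)"

definition free_involution :: "'a topology \<Rightarrow> ('a \<Rightarrow> 'a) \<Rightarrow> bool" where
  "free_involution X \<tau> \<longleftrightarrow>
     continuous_map X X \<tau> \<and> (\<forall>x\<in>topspace X. \<tau> (\<tau> x) = x \<and> \<tau> x \<noteq> x)"

definition orbit_map :: "('a \<Rightarrow> 'a) \<Rightarrow> 'a \<Rightarrow> 'a set" where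
  "orbit_map \<tau> x = {x, \<tau> x}"

definition orbit_space :: "'a topology \<Rightarrow> ('a \<Rightarrow> 'a) \<Rightarrow> 'a set topology" where
  "orbit_space X \<tau> = topology (\<lambda>U. U \<subseteq> orbit_map \<tau> ` topspace X \<and>
                                    openin X {x \<in> topspace X. orbit_map \<tau> x \<in> U})"

lemma openin_orbit_space:
  "openin (orbit_space X \<tau>) U \<longleftrightarrow>
     U \<subseteq> orbit_map \<tau> ` topspace X \<and> openin X {x \<in> topspace X. orbit_map \<tau> x \<in> U}"
proof -
  let ?P = "\<lambda>U. U \<subseteq> orbit_map \<tau> ` topspace X \<and> openin X {x \<in> topspace X. orbit_map \<tau> x \<in> U}"
  have "?P (S \<inter> T)" if "?P S" "?P T" for S T
  proof -
    have "{x \<in> topspace X. orbit_map \<tau> x \<in> S \<inter> T} =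
          {x \<in> topspace X. orbit_map \<tau> x \<in> S} \<inter> {x \<in> topspace X. orbit_map \<tau> x \<in> T}"
      by blast
    with that show ?thesis by auto
  qed
  moreover have "?P (\<Union>\<K>)" if "\<forall>K\<in>\<K>. ?P K" for \<K>
  proof -
    have "{x \<in> topspace X. orbit_map \<tau> x \<in> \<Union>\<K>} =
          (\<Union>K\<in>\<K>. {x \<in> topspace X. orbit_map \<tau> x \<in> K})"
      by blast
    with that show ?thesis by auto
  qed
  ultimately have "istopology ?P"
    unfolding istopology_def by blast
  then show ?thesis
    by (simp add: orbit_space_def)
qed

lemma topspace_orbit_space: "topspace (orbit_space X \<tau>) = orbit_map \<tau> ` topspace X"
proof
  show "topspace (orbit_space X \<tau>) \<subseteq> orbit_map \<tau> ` topspace X"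
    using openin_orbit_space openin_topspace by blast
  have "{x \<in> topspace X. orbit_map \<tau> x \<in> orbit_map \<tau> ` topspace X} = topspace X"
    by blast
  then show "orbit_map \<tau> ` topspace X \<subseteq> topspace (orbit_space X \<tau>)"
    by (intro openin_subset) (simp add: openin_orbit_space)
qed

lemma quotient_map_orbit_map: "quotient_map X (orbit_space X \<tau>) (orbit_map \<tau>)"
  by (auto simp: quotient_map_def topspace_orbit_space openin_orbit_space)

text \<open>The infimum of the empty set in \<^typ>\<open>enat\<close> is \<open>\<infinity>\<close>.\<close>

definition involution_index :: "'a topology \<Rightarrow> ('a \<Rightarrow> 'a) \<Rightarrow> enat" where
  "involution_index X \<tau> =
     Inf {enat n | n. \<exists>f. continuous_map X (nsphere n) f \<and>
                          (\<forall>x\<in>topspace X. f (\<tau> x) = (\<lambda>i. - f x i))}"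

definition has_local_section ::
  "'a topology \<Rightarrow> 'b topology \<Rightarrow> ('a \<Rightarrow> 'b) \<Rightarrow> 'b set \<Rightarrow> bool" where
  "has_local_section X Y q U \<longleftrightarrow>
     (\<exists>s. continuous_map (subtopology Y U) X s \<and> (\<forall>y\<in>U. q (s y) = y))"

definition secat :: "'a topology \<Rightarrow> 'b topology \<Rightarrow> ('a \<Rightarrow> 'b) \<Rightarrow> enat" where
  "secat X Y q =
     Inf {enat (card \<U>) | \<U>. finite \<U> \<and> \<Union>\<U> = topspace Y \<and>
                             (\<forall>U\<in>\<U>. openin Y U \<and> has_local_section X Y q U)}"

end

theory Submission
  imports Defs
begin

text \<open>
  For a free involution on a normal Hausdorff space \<open>M\<close>, index and sectional category carry the same
  information: \<open>secat q \<le> n + 1\<close> holds if and only if the index is at most \<open>n\<close>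
  (\<open>secat_le_iff_involution_index_le\<close>). Both inequalities say that \<open>M\<close> is covered by \<open>n + 1\<close> open
  sets \<open>W\<^sub>0, \<dots>, W\<^sub>n\<close>, each disjoint from its mirror image, together with these mirror images.

  A continuous section over an open set \<open>U\<close> of orbits picks one of the two sheets over \<open>U\<close>. The chosen
  sheet is open because \<open>M\<close> is Hausdorff, and it is disjoint from the other one. Conversely, the
  quotient map is open and is injective on an open set that misses its mirror image, so that it has a
  continuous inverse there. An equivariant map \<open>f\<close> to the \<open>n\<close>-sphere gives the open sets
  \<open>W\<^sub>i = {x. f\<^sub>i x > 0}\<close>, since some coordinate of \<open>f x\<close> is nonzero. For the way back, the
  cover is shrunk to closed sets \<open>C\<^sub>i \<subseteq> W\<^sub>i \<union> \<tau> W\<^sub>i\<close>, and Urysohn's lemma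
  provides odd functions \<open>h\<^sub>i\<close> without zeros on \<open>C\<^sub>i\<close>. They have no common zero, and
  normalizing the vector \<open>(h\<^sub>0, \<dots>, h\<^sub>n)\<close> gives an equivariant map to the \<open>n\<close>-sphere.

  The topological input is that a CW complex is normal. This follows from a Tietze extension theorem
  (\<open>Tietze_extension_cw_complex\<close>): a real function on a closed subset is extended over one skeleton
  after another, on each cell by the Tietze theorem for the closed disc.

  Since a complex of dimension \<open>m\<close> has a cell and cells are nonempty, the cover in the definition of
  the sectional category cannot be empty. Hence \<open>m \<noteq> 0\<close>, and the truncated subtraction in
  \<open>m - 1\<close> does no harm.
\<close>

section \<open>Normality of CW complexes\<close>

lemma unit_disc_eq: "unit_disc n = top_of_set {x. (\<forall>i\<ge>n. x i = 0) \<and> (\<Sum>i<n. (x i)\<^sup>2) \<le> 1}"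
  by (simp add: unit_disc_def Euclidean_space_def subtopology_subtopology euclidean_product_topology Int_def)

lemma Hausdorff_unit_disc: "Hausdorff_space (unit_disc n)"
  by (simp add: unit_disc_eq Hausdorff_space_subtopology)

lemma compact_unit_disc: "compact_space (unit_disc n)"
proof -
  let ?D = "{x. (\<forall>i\<ge>n. x i = 0) \<and> (\<Sum>i<n. (x i)\<^sup>2) \<le> (1::real)}"
  have "compactin (powertop_real UNIV) (\<Pi>\<^sub>E i\<in>UNIV. {-1..1})"
    by (simp add: compactin_PiE)
  then have cube: "compact (\<Pi>\<^sub>E i\<in>(UNIV::nat set). {-1..1::real})"
    by (simp add: euclidean_product_topology)
  have "x i \<in> {-1..1}" if "x \<in> ?D" for x i
  proof (cases "i < n")
    case True
    have "(x i)\<^sup>2 \<le> (\<Sum>i<n. (x i)\<^sup>2)"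
      using True by (intro member_le_sum) auto
    then have "(x i)\<^sup>2 \<le> 1"
      using that by auto
    then show ?thesis
      unfolding abs_square_le_1 by auto
  qed (use that in auto)
  then have sub: "?D \<subseteq> (\<Pi>\<^sub>E i\<in>UNIV. {-1..1})"
    by auto
  have "closed ?D"
  proof -
    have "?D = (\<Inter>i\<in>{n..}. {x. x i = 0}) \<inter> {x. (\<Sum>i<n. (x i)\<^sup>2) \<le> 1}"
      by auto
    moreover have "closed {x::nat\<Rightarrow>real. x i = 0}" for i
      by (intro closed_Collect_eq continuous_intros) auto
    moreover have "closed {x::nat\<Rightarrow>real. (\<Sum>i<n. (x i)\<^sup>2) \<le> 1}"
      by (intro closed_Collect_le continuous_intros) auto
    ultimately show ?thesis
      by (auto intro!: closed_Int closed_INT)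
  qed
  from compact_Int_closed[OF cube this] sub have "compact ?D"
    by (simp only: Int_absorb1)
  then show ?thesis
    by (simp add: unit_disc_eq compact_space_subtopology)
qed

lemma normal_unit_disc: "normal_space (unit_disc n)"
  by (simp add: Hausdorff_unit_disc compact_Hausdorff_or_regular_imp_normal_space compact_unit_disc)

lemma closedin_disc_boundary: "closedin (unit_disc n) (disc_boundary n)"
proof -
  have "closed {x::nat\<Rightarrow>real. (\<Sum>i<n. (x i)\<^sup>2) = 1}"
    by (intro closed_Collect_eq continuous_intros) auto
  moreover have "disc_boundary n = topspace (unit_disc n) \<inter> {x. (\<Sum>i<n. (x i)\<^sup>2) = 1}"
    by (auto simp: disc_boundary_def)
  ultimately show ?thesis
    by (auto simp: unit_disc_eq closedin_closed)
qed

lemma topspace_unit_disc_split: "topspace (unit_disc n) = disc_interior n \<union> disc_boundary n"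
  by (auto simp: disc_interior_def disc_boundary_def unit_disc_eq)

lemma disc_interior_nonempty: "disc_interior n \<noteq> {}"
proof -
  have "(\<lambda>i. 0) \<in> disc_interior n"
    by (simp add: disc_interior_def unit_disc_eq)
  then show ?thesis
    by blast
qed

lemma cell_subset_topspace: "cw_complex X E \<Longrightarrow> e \<in> E n \<Longrightarrow> e \<subseteq> topspace X"
  by (auto simp: cw_complex_def)

lemma closedin_cw_complex_iff:
  assumes "cw_complex X E" "A \<subseteq> topspace X"
  shows "closedin X A \<longleftrightarrow> (\<forall>n. \<forall>e\<in>E n. closedin X (A \<inter> X closure_of e))"
  using assms(1)[unfolded cw_complex_def, THEN conjunct2, THEN conjunct2, THEN conjunct2,
      THEN conjunct2, THEN spec, THEN mp, OF assms(2)] .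

lemma cell_unique:
  assumes "cw_complex X E" "e \<in> E n" "e' \<in> E k" "y \<in> e" "y \<in> e'"
  shows "n = k \<and> e = e'"
  using assms unfolding cw_complex_def disjnt_iff by (metis Pair_inject)

lemma cell_dimension_unique:
  assumes "cw_complex X E" "y \<in> \<Union>(E n)" "y \<in> \<Union>(E k)"
  shows "n = k"
  using assms(2,3) cell_unique[OF assms(1)] by blast

lemma characteristic_map_interior:
  assumes "characteristic_map X E n e \<phi>" "e \<subseteq> topspace X"
  shows "\<phi> ` disc_interior n = e" "inj_on \<phi> (disc_interior n)"
proof -
  have "homeomorphic_map (subtopology (unit_disc n) (disc_interior n)) (subtopology X e) \<phi>"
    using assms by (simp add: characteristic_map_def)
  moreover have "topspace (subtopology (unit_disc n) (disc_interior n)) = disc_interior n"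
    by (auto simp: disc_interior_def)
  moreover have "topspace (subtopology X e) = e"
    using assms(2) by (rule topspace_subtopology_subset)
  ultimately show "\<phi> ` disc_interior n = e" "inj_on \<phi> (disc_interior n)"
    using homeomorphic_imp_surjective_map homeomorphic_imp_injective_map by metis+
qed

lemma characteristic_map_boundary:
  assumes "characteristic_map X E n e \<phi>" "x \<in> disc_boundary n"
  shows "\<exists>k<n. \<phi> x \<in> \<Union>(E k)"
  using assms unfolding characteristic_map_def by blast

lemma characteristic_map_disc:
  assumes "characteristic_map X E n e \<phi>" "e \<in> E n" "e \<subseteq> topspace X" "x \<in> topspace (unit_disc n)"
  shows "\<exists>k\<le>n. \<phi> x \<in> \<Union>(E k)"
proof (cases "x \<in> disc_boundary n")
  case True
  then show ?thesis
    using characteristic_map_boundary[OF assms(1)] less_imp_le by blast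
next
  case False
  then have "\<phi> x \<in> e"
    using assms(4) topspace_unit_disc_split characteristic_map_interior(1)[OF assms(1,3)] by blast
  then show ?thesis
    using assms(2) by blast
qed

text \<open>Characteristic maps are closed maps, because the disc is compact and \<open>X\<close> is Hausdorff. This is how
  the discs control the topology of \<open>X\<close>.\<close>

lemma closedin_characteristic_image:
  assumes "Hausdorff_space X" "characteristic_map X E n e \<phi>" "closedin (unit_disc n) C"
  shows "closedin X (\<phi> ` C)"
proof -
  have "compactin (unit_disc n) C"
    using assms(3) closedin_compact_space compact_unit_disc by blast
  then show ?thesis
    using assms(1,2) compactin_imp_closedin image_compactin
    unfolding characteristic_map_def by blast
qed

text \<open>In the weak topology, continuity is tested on closures of cells. The closure of a cell lies in the
  closed image of its disc, so it suffices to test on the discs.\<close>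

lemma continuous_map_from_cw_complex:
  assumes cw: "cw_complex X E"
    and range: "g \<in> topspace X \<rightarrow> topspace Y"
    and cells: "\<And>n e. e \<in> E n \<Longrightarrow>
      \<exists>\<phi>. characteristic_map X E n e \<phi> \<and> continuous_map (unit_disc n) Y (g \<circ> \<phi>)"
  shows "continuous_map X Y g"
  unfolding continuous_map_closedin
proof (intro conjI allI impI)
  show "g \<in> topspace X \<rightarrow> topspace Y"
    by (fact range)
next
  fix C assume C: "closedin Y C"
  let ?A = "{x \<in> topspace X. g x \<in> C}"
  have haus: "Hausdorff_space X"
    using cw by (simp add: cw_complex_def)
  have "closedin X (?A \<inter> X closure_of e)" if e: "e \<in> E n" for n e
  proof -
    obtain \<phi> where \<phi>: "characteristic_map X E n e \<phi>"
      and g\<phi>: "continuous_map (unit_disc n) Y (g \<circ> \<phi>)"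
      using cells e by blast
    have cont: "continuous_map (unit_disc n) X \<phi>"
      using \<phi> by (simp add: characteristic_map_def)
    let ?B = "{x \<in> topspace (unit_disc n). (g \<circ> \<phi>) x \<in> C}"
    have B: "closedin X (\<phi> ` ?B)"
      using closedin_continuous_map_preimage[OF g\<phi> C]
        closedin_characteristic_image[OF haus \<phi>] by blast
    have "e \<subseteq> \<phi> ` topspace (unit_disc n)"
      using characteristic_map_interior(1)[OF \<phi> cell_subset_topspace[OF cw e]]
      by (auto simp: disc_interior_def)
    then have "X closure_of e \<subseteq> \<phi> ` topspace (unit_disc n)"
      using closedin_characteristic_image[OF haus \<phi>] closure_of_minimal by blast
    then have "?A \<inter> X closure_of e = \<phi> ` ?B \<inter> X closure_of e"
      using continuous_map_image_subset_topspace[OF cont] by auto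
    then show ?thesis
      using B by (simp add: closedin_Int)
  qed
  then have "\<forall>n. \<forall>e\<in>E n. closedin X (?A \<inter> X closure_of e)"
    by blast
  moreover have "?A \<subseteq> topspace X"
    by blast
  ultimately show "closedin X ?A"
    using closedin_cw_complex_iff[OF cw] by blast
qed

text \<open>The function \<open>h\<close> itself need not be continuous on \<open>X\<close>: it is only known to be
  continuous on the discs of the finitely many cells that \<open>\<psi>\<close> meets. The lemma is applied with an attaching
  map in the role of \<open>\<psi>\<close>, where closure-finiteness provides \<open>F\<close>. The preimage of a
  closed set is then a finite union of closed sets, one for each cell in \<open>F\<close>.\<close>

lemma continuous_map_through_finite_cells:
  assumes haus: "Hausdorff_space X" and \<psi>: "continuous_map Z X \<psi>"
    and F: "finite F" "\<psi> ` topspace Z \<subseteq> \<Union>F"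
    and cells: "\<And>e. e \<in> F \<Longrightarrow> e \<subseteq> topspace X"
    and \<phi>: "\<And>e. e \<in> F \<Longrightarrow> characteristic_map X E (k e) e (\<phi> e)"
    and h\<phi>: "\<And>e. e \<in> F \<Longrightarrow> continuous_map (unit_disc (k e)) Y (h \<circ> \<phi> e)"
  shows "continuous_map Z Y (h \<circ> \<psi>)"
proof -
  have cover: "\<exists>e\<in>F. \<exists>x\<in>topspace (unit_disc (k e)). \<psi> z = \<phi> e x" if "z \<in> topspace Z" for z
  proof -
    have "\<psi> z \<in> \<Union>F"
      using F(2) that by (simp add: image_subset_iff)
    then obtain e where e: "e \<in> F" "\<psi> z \<in> e"
      by (rule UnionE)
    then have "\<phi> e ` disc_interior (k e) = e"
      using characteristic_map_interior(1)[OF \<phi> cells] by simp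
    with e(2) obtain x where "x \<in> disc_interior (k e)" "\<psi> z = \<phi> e x"
      by (metis imageE)
    then show ?thesis
      using e(1) by (auto simp: disc_interior_def)
  qed
  show ?thesis
    unfolding continuous_map_closedin
  proof (intro conjI allI impI)
    show "h \<circ> \<psi> \<in> topspace Z \<rightarrow> topspace Y"
    proof
      fix z assume "z \<in> topspace Z"
      then obtain e x where "e \<in> F" "x \<in> topspace (unit_disc (k e))" "\<psi> z = \<phi> e x"
        using cover by blast
      then show "(h \<circ> \<psi>) z \<in> topspace Y"
        using continuous_map_image_subset_topspace[OF h\<phi>] by (auto simp: image_subset_iff)
    qed
  next
    fix C assume C: "closedin Y C"
    let ?P = "\<lambda>e. \<phi> e ` {x \<in> topspace (unit_disc (k e)). (h \<circ> \<phi> e) x \<in> C}"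
    have "closedin X (?P e)" if "e \<in> F" for e
      using closedin_continuous_map_preimage[OF h\<phi>[OF that] C]
        closedin_characteristic_image[OF haus \<phi>[OF that]] by blast
    then have "closedin X (\<Union>e\<in>F. ?P e)"
      using F(1) by (intro closedin_Union) auto
    then have "closedin Z {z \<in> topspace Z. \<psi> z \<in> (\<Union>e\<in>F. ?P e)}"
      using \<psi> closedin_continuous_map_preimage by blast
    moreover have "{z \<in> topspace Z. \<psi> z \<in> (\<Union>e\<in>F. ?P e)} = {z \<in> topspace Z. (h \<circ> \<psi>) z \<in> C}"
    proof (intro Collect_cong conj_cong refl iffI)
      fix z assume z: "z \<in> topspace Z"
      show "(h \<circ> \<psi>) z \<in> C" if "\<psi> z \<in> (\<Union>e\<in>F. ?P e)"
        using that by auto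
      obtain e x where "e \<in> F" "x \<in> topspace (unit_disc (k e))" "\<psi> z = \<phi> e x"
        using cover[OF z] by blast
      then show "\<psi> z \<in> (\<Union>e\<in>F. ?P e)" if "(h \<circ> \<psi>) z \<in> C"
        using that by auto
    qed
    ultimately show "closedin Z {z \<in> topspace Z. (h \<circ> \<psi>) z \<in> C}"
      by simp
  qed
qed

text \<open>The function \<open>h\<close> is already as it should be on all cells of dimension below \<open>n\<close> and on
  \<open>A\<close>. Pulled back to the disc of an \<open>n\<close>-cell, it is therefore prescribed on the
  closed set formed by the boundary sphere and the preimage of \<open>A\<close>. It is continuous there, since
  it is continuous on each of these two closed pieces, and the Tietze theorem for the disc applies.\<close>

lemma extend_over_disc:
  assumes cw: "cw_complex X E" and A: "closedin X A"
    and hA: "continuous_map (subtopology X A) euclideanreal h"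
    and char: "\<And>k e. e \<in> E k \<Longrightarrow> characteristic_map X E k e (\<Phi> k e)"
    and lower: "\<And>k e. k < n \<Longrightarrow> e \<in> E k \<Longrightarrow>
      continuous_map (unit_disc k) euclideanreal (h \<circ> \<Phi> k e)"
    and e: "e \<in> E n"
  shows "\<exists>G. continuous_map (unit_disc n) euclideanreal G \<and>
    (\<forall>x\<in>topspace (unit_disc n). x \<in> disc_boundary n \<or> \<Phi> n e x \<in> A \<longrightarrow> G x = h (\<Phi> n e x))"
proof -
  let ?D = "unit_disc n" and ?\<phi> = "\<Phi> n e"
  let ?S = "{x \<in> topspace ?D. x \<in> disc_boundary n \<or> ?\<phi> x \<in> A}"
  have haus: "Hausdorff_space X"
    using cw by (simp add: cw_complex_def)
  have cont: "continuous_map ?D X ?\<phi>"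
    using char[OF e] by (simp add: characteristic_map_def)
  obtain F where F: "finite F" "F \<subseteq> (\<Union>k<n. E k)" "?\<phi> ` disc_boundary n \<subseteq> \<Union>F"
    using char[OF e] by (auto simp: characteristic_map_def)
  have "\<forall>e'\<in>F. \<exists>k. k < n \<and> e' \<in> E k"
    using F(2) by blast
  then obtain k where k: "\<And>e'. e' \<in> F \<Longrightarrow> k e' < n \<and> e' \<in> E (k e')"
    using bchoice[of F "\<lambda>e' k. k < n \<and> e' \<in> E k"] by blast
  have bd: "continuous_map (subtopology ?D (disc_boundary n)) euclideanreal (h \<circ> ?\<phi>)"
  proof (rule continuous_map_through_finite_cells[OF haus _ F(1)])
    show "continuous_map (subtopology ?D (disc_boundary n)) X ?\<phi>"
      using cont continuous_map_from_subtopology by blast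
    show "?\<phi> ` topspace (subtopology ?D (disc_boundary n)) \<subseteq> \<Union>F"
      using F(3) by auto
    fix e' assume "e' \<in> F"
    then have k': "k e' < n" "e' \<in> E (k e')"
      using k by auto
    show "e' \<subseteq> topspace X"
      using cell_subset_topspace[OF cw k'(2)] .
    show "characteristic_map X E (k e') e' (\<Phi> (k e') e')"
      using char[OF k'(2)] .
    show "continuous_map (unit_disc (k e')) euclideanreal (h \<circ> \<Phi> (k e') e')"
      using lower[OF k'] .
  qed
  \<comment> \<open>Continuity on the union of the two closed pieces; the case of all reals shows that the union is
    closed.\<close>
  have SC: "closedin ?D {x \<in> ?S. h (?\<phi> x) \<in> C}" if C: "closed C" for C
  proof -
    have "closedin (subtopology ?D (disc_boundary n))
        {x \<in> topspace (subtopology ?D (disc_boundary n)). (h \<circ> ?\<phi>) x \<in> C}"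
      using closedin_continuous_map_preimage[OF bd] C by simp
    then have 1: "closedin ?D
        {x \<in> topspace (subtopology ?D (disc_boundary n)). (h \<circ> ?\<phi>) x \<in> C}"
      using closedin_disc_boundary closedin_closed_subtopology by blast
    have "closedin (subtopology X A) {y \<in> topspace (subtopology X A). h y \<in> C}"
      using closedin_continuous_map_preimage[OF hA] C by simp
    then have "closedin X {y \<in> topspace (subtopology X A). h y \<in> C}"
      using A closedin_closed_subtopology by blast
    then have 2: "closedin ?D {x \<in> topspace ?D. ?\<phi> x \<in> {y \<in> topspace (subtopology X A). h y \<in> C}}"
      using closedin_continuous_map_preimage[OF cont] by blast
    have "{x \<in> ?S. h (?\<phi> x) \<in> C} =
        {x \<in> topspace (subtopology ?D (disc_boundary n)). (h \<circ> ?\<phi>) x \<in> C} \<union>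
        {x \<in> topspace ?D. ?\<phi> x \<in> {y \<in> topspace (subtopology X A). h y \<in> C}}"
      using continuous_map_image_subset_topspace[OF cont] by auto
    then show ?thesis
      using closedin_Un[OF 1 2] by simp
  qed
  have S: "closedin ?D ?S"
    using SC[of UNIV] by simp
  have "continuous_map (subtopology ?D ?S) euclideanreal (h \<circ> ?\<phi>)"
    unfolding continuous_map_closedin
  proof (intro conjI allI impI)
    fix C :: "real set" assume "closedin euclideanreal C"
    then have "closedin ?D {x \<in> ?S. h (?\<phi> x) \<in> C}"
      using SC by simp
    moreover have "{x \<in> topspace (subtopology ?D ?S). (h \<circ> ?\<phi>) x \<in> C} = {x \<in> ?S. h (?\<phi> x) \<in> C}"
      by auto
    ultimately show "closedin (subtopology ?D ?S)
        {x \<in> topspace (subtopology ?D ?S). (h \<circ> ?\<phi>) x \<in> C}"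
      using closedin_closed_subtopology[OF S] by auto
  qed auto
  then show ?thesis
  proof (rule Tietze_extension_realinterval[OF normal_unit_disc S is_interval_univ UNIV_not_empty _ subset_UNIV])
    fix G assume "continuous_map ?D euclideanreal G" "\<And>x. x \<in> ?S \<Longrightarrow> G x = (h \<circ> ?\<phi>) x"
    then show ?thesis
      by (intro exI[of _ G]) simp
  qed
qed

text \<open>The values of \<open>h\<close> are changed only on the open \<open>n\<close>-cells, each of which is the
  injective image of the interior of its disc. The new function agrees with the extension to the disc also
  on the boundary, whose points are sent to cells of lower dimension, where nothing is changed.\<close>

lemma extend_over_cells:
  assumes cw: "cw_complex X E" and A: "closedin X A"
    and hA: "continuous_map (subtopology X A) euclideanreal h"
    and char: "\<And>k e. e \<in> E k \<Longrightarrow> characteristic_map X E k e (\<Phi> k e)"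
    and lower: "\<And>k e. k < n \<Longrightarrow> e \<in> E k \<Longrightarrow>
      continuous_map (unit_disc k) euclideanreal (h \<circ> \<Phi> k e)"
  shows "\<exists>h'. (\<forall>y\<in>A. h' y = h y) \<and> (\<forall>y. y \<notin> \<Union>(E n) \<longrightarrow> h' y = h y) \<and>
    (\<forall>k\<le>n. \<forall>e\<in>E k. continuous_map (unit_disc k) euclideanreal (h' \<circ> \<Phi> k e))"
proof -
  have disc: "\<forall>e\<in>E n. \<exists>G. continuous_map (unit_disc n) euclideanreal G \<and>
      (\<forall>x\<in>topspace (unit_disc n). x \<in> disc_boundary n \<or> \<Phi> n e x \<in> A \<longrightarrow> G x = h (\<Phi> n e x))"
    by (intro ballI extend_over_disc[OF cw A hA char lower])
  obtain G where G: "\<And>e. e \<in> E n \<Longrightarrow> continuous_map (unit_disc n) euclideanreal (G e)"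
    and Gh: "\<And>e x. e \<in> E n \<Longrightarrow> x \<in> topspace (unit_disc n) \<Longrightarrow>
      x \<in> disc_boundary n \<or> \<Phi> n e x \<in> A \<Longrightarrow> G e x = h (\<Phi> n e x)"
    using bchoice[OF disc] by blast
  \<comment> \<open>The \<open>n\<close>-cell that contains \<open>y\<close>, if there is one.\<close>
  define c where "c y = (SOME e. e \<in> E n \<and> y \<in> e)" for y
  have c: "c y = e" if "e \<in> E n" "y \<in> e" for y e
    unfolding c_def using that cell_unique[OF cw] by (intro some_equality) blast+
  define h' where "h' y = (if y \<in> \<Union>(E n) then G (c y) (inv_into (disc_interior n) (\<Phi> n (c y)) y)
    else h y)" for y
  have interior: "\<Phi> n e x \<in> e \<and> h' (\<Phi> n e x) = G e x" if e: "e \<in> E n" and x: "x \<in> disc_interior n" for e x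
  proof -
    note ch = characteristic_map_interior[OF char[OF e] cell_subset_topspace[OF cw e]]
    have "\<Phi> n e x \<in> e"
      using ch x by blast
    moreover from this have "\<Phi> n e x \<in> \<Union>(E n)" "c (\<Phi> n e x) = e"
      using e c[OF e] by auto
    moreover have "inv_into (disc_interior n) (\<Phi> n e) (\<Phi> n e x) = x"
      using ch(2) x by (rule inv_into_f_f)
    ultimately show ?thesis
      unfolding h'_def by simp
  qed
  have lower_point: "\<Phi> k e x \<notin> \<Union>(E n)"
    if e: "e \<in> E k" and "k < n \<or> k = n \<and> x \<in> disc_boundary n" and x: "x \<in> topspace (unit_disc k)" for k e x
  proof -
    have "\<exists>l<n. \<Phi> k e x \<in> \<Union>(E l)"
      using that(2)
    proof
      assume "k < n"
      obtain l where "l \<le> k" "\<Phi> k e x \<in> \<Union>(E l)"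
        using characteristic_map_disc[OF char[OF e] e cell_subset_topspace[OF cw e] x] by blast
      with \<open>k < n\<close> show ?thesis
        by (intro exI[of _ l]) simp
    next
      assume "k = n \<and> x \<in> disc_boundary n"
      then show ?thesis
        using characteristic_map_boundary[OF char[OF e], of x] by simp
    qed
    then obtain l where "l < n" "\<Phi> k e x \<in> \<Union>(E l)"
      by blast
    then show ?thesis
      using cell_dimension_unique[OF cw, of "\<Phi> k e x" l n] by auto
  qed
  have "h' y = h y" if "y \<in> A" for y
  proof (cases "y \<in> \<Union>(E n)")
    case True
    then obtain e where e: "e \<in> E n" "y \<in> e"
      by blast
    then obtain x where x: "x \<in> disc_interior n" "y = \<Phi> n e x"
      using characteristic_map_interior(1)[OF char[OF e(1)] cell_subset_topspace[OF cw e(1)]]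
      by blast
    then show ?thesis
      using interior[OF e(1) x(1)] Gh[OF e(1)] that by (simp add: topspace_unit_disc_split)
  qed (simp add: h'_def)
  moreover have "h' y = h y" if "y \<notin> \<Union>(E n)" for y
    using that by (simp add: h'_def)
  moreover have "continuous_map (unit_disc k) euclideanreal (h' \<circ> \<Phi> k e)" if "k \<le> n" and e: "e \<in> E k" for k e
  proof (cases "k = n")
    case True
    have "G e x = (h' \<circ> \<Phi> k e) x" if x: "x \<in> topspace (unit_disc n)" for x
    proof (cases "x \<in> disc_boundary n")
      case bd: True
      then show ?thesis
        using lower_point[of e k x] Gh[of e x] e True x by (simp add: h'_def)
    next
      case False
      then show ?thesis
        using interior[of e x] x e True topspace_unit_disc_split[of n] by auto
    qed
    then show ?thesis
      using G[of e] e True continuous_map_eq by blast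
  next
    case False
    then have "k < n"
      using that by simp
    then have "(h \<circ> \<Phi> k e) x = (h' \<circ> \<Phi> k e) x" if "x \<in> topspace (unit_disc k)" for x
      using lower_point[OF e _ that] by (simp add: h'_def)
    then show ?thesis
      using lower[OF \<open>k < n\<close> e] continuous_map_eq by blast
  qed
  ultimately show ?thesis
    by blast
qed

text \<open>The extensions over successive skeleta are chosen in turn. The values at a point of a \<open>k\<close>-cell
  are constant from stage \<open>k + 1\<close> on, so the stages have a pointwise limit; on the disc of an
  \<open>n\<close>-cell the limit coincides with stage \<open>n + 1\<close>.\<close>

theorem Tietze_extension_cw_complex:
  assumes cw: "cw_complex X E" and A: "closedin X A"
    and f: "continuous_map (subtopology X A) euclideanreal f"
  obtains g where "continuous_map X euclideanreal g" "\<And>y. y \<in> A \<Longrightarrow> g y = f y"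
proof -
  define \<Phi> where "\<Phi> k e = (SOME \<phi>. characteristic_map X E k e \<phi>)" for k e
  have char: "characteristic_map X E k e (\<Phi> k e)" if "e \<in> E k" for k e
  proof -
    have "\<exists>\<phi>. characteristic_map X E k e \<phi>"
      using cw that by (simp add: cw_complex_def)
    then show ?thesis
      unfolding \<Phi>_def by (rule someI_ex)
  qed
  define P where "P n h \<longleftrightarrow> (\<forall>y\<in>A. h y = f y) \<and>
    (\<forall>k<n. \<forall>e\<in>E k. continuous_map (unit_disc k) euclideanreal (h \<circ> \<Phi> k e))" for n h
  have "\<exists>h. \<forall>n. P n (h n) \<and> (\<forall>y. y \<notin> \<Union>(E n) \<longrightarrow> h (Suc n) y = h n y)"
  proof (rule dependent_nat_choice)
    show "\<exists>h. P 0 h"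
      by (auto simp: P_def)
  next
    fix h n assume h: "P n h"
    have "continuous_map (subtopology X A) euclideanreal h"
      using f by (rule continuous_map_eq) (use h in \<open>auto simp: P_def\<close>)
    then have "\<exists>h'. (\<forall>y\<in>A. h' y = h y) \<and> (\<forall>y. y \<notin> \<Union>(E n) \<longrightarrow> h' y = h y) \<and>
        (\<forall>k\<le>n. \<forall>e\<in>E k. continuous_map (unit_disc k) euclideanreal (h' \<circ> \<Phi> k e))"
      by (rule extend_over_cells[OF cw A _ char]) (use h in \<open>auto simp: P_def\<close>)
    then show "\<exists>h'. P (Suc n) h' \<and> (\<forall>y. y \<notin> \<Union>(E n) \<longrightarrow> h' y = h y)"
      using h unfolding P_def by (metis less_Suc_eq_le)
  qed
  then obtain h where "\<forall>n. P n (h n) \<and> (\<forall>y. y \<notin> \<Union>(E n) \<longrightarrow> h (Suc n) y = h n y)" ..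
  then have P: "P n (h n)" and agree: "y \<notin> \<Union>(E n) \<Longrightarrow> h (Suc n) y = h n y" for n y
    by blast+
  have stable: "h n y = h (Suc k) y" if "Suc k \<le> n" and y: "y \<in> \<Union>(E k)" for n k y
    using that(1)
  proof (induction n rule: dec_induct)
    case (step n)
    then have "y \<notin> \<Union>(E n)"
      using cell_dimension_unique[OF cw y, of n] by force
    then show ?case
      using step.IH agree by simp
  qed simp
  define g where "g y = h (Suc (SOME k. y \<in> \<Union>(E k))) y" for y
  have g: "g y = h (Suc k) y" if "y \<in> \<Union>(E k)" for y k
  proof -
    have "(SOME k. y \<in> \<Union>(E k)) = k"
      using that cell_dimension_unique[OF cw _ that] by (rule some_equality)
    then show ?thesis
      by (simp add: g_def)
  qed
  show ?thesis
  proof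
    show "g y = f y" if "y \<in> A" for y
      using P that by (simp add: g_def P_def)
    show "continuous_map X euclideanreal g"
    proof (rule continuous_map_from_cw_complex[OF cw])
      fix n e assume e: "e \<in> E n"
      have "(h (Suc n) \<circ> \<Phi> n e) x = (g \<circ> \<Phi> n e) x" if x: "x \<in> topspace (unit_disc n)" for x
      proof -
        have "\<exists>k\<le>n. \<Phi> n e x \<in> \<Union>(E k)"
          using characteristic_map_disc[OF char[OF e] e cell_subset_topspace[OF cw e] x] .
        then obtain k where "k \<le> n" "\<Phi> n e x \<in> \<Union>(E k)"
          by blast
        then show ?thesis
          using stable[of k "Suc n" "\<Phi> n e x"] g[of "\<Phi> n e x" k] by simp
      qed
      moreover have "continuous_map (unit_disc n) euclideanreal (h (Suc n) \<circ> \<Phi> n e)"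
        using P[of "Suc n"] e by (simp add: P_def)
      ultimately have "continuous_map (unit_disc n) euclideanreal (g \<circ> \<Phi> n e)"
        using continuous_map_eq by blast
      then show "\<exists>\<phi>. characteristic_map X E n e \<phi> \<and>
          continuous_map (unit_disc n) euclideanreal (g \<circ> \<phi>)"
        using char[OF e] by blast
    qed auto
  qed
qed

corollary normal_space_cw_complex:
  assumes "cw_complex X E"
  shows "normal_space X"
  unfolding normal_space_iff_Tietze
  by (metis Tietze_extension_cw_complex assms)

section \<open>Slices of a free involution\<close>

text \<open>A slice is an open set that lies in one sheet over its image in the orbit space. Covers by slices and
  their mirror images are the common form of the two invariants.\<close>

definition slice :: "'a topology \<Rightarrow> ('a \<Rightarrow> 'a) \<Rightarrow> 'a set \<Rightarrow> bool" where
  "slice M \<tau> W \<longleftrightarrow> openin M W \<and> disjnt W (\<tau> ` W)"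

definition slice_cover :: "'a topology \<Rightarrow> ('a \<Rightarrow> 'a) \<Rightarrow> nat \<Rightarrow> (nat \<Rightarrow> 'a set) \<Rightarrow> bool" where
  "slice_cover M \<tau> n W \<longleftrightarrow> (\<forall>i\<le>n. slice M \<tau> (W i)) \<and> (\<forall>x\<in>topspace M. \<exists>i\<le>n. x \<in> W i \<or> \<tau> x \<in> W i)"

lemma free_involutionD:
  assumes "free_involution M \<tau>" "x \<in> topspace M"
  shows "\<tau> x \<in> topspace M" "\<tau> (\<tau> x) = x" "\<tau> x \<noteq> x"
  using assms continuous_map_image_subset_topspace[of M M \<tau>] by (auto simp: free_involution_def)

lemma orbit_map_eq_iff:
  assumes "free_involution M \<tau>" "x \<in> topspace M"
  shows "orbit_map \<tau> x = orbit_map \<tau> y \<longleftrightarrow> y = x \<or> y = \<tau> x"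
  using free_involutionD[OF assms] by (auto simp: orbit_map_def doubleton_eq_iff)

lemma orbit_map_involution:
  assumes "free_involution M \<tau>" "x \<in> topspace M"
  shows "orbit_map \<tau> (\<tau> x) = orbit_map \<tau> x"
  using free_involutionD[OF assms] by (auto simp: orbit_map_def)

lemma slice_not_both:
  assumes "slice M \<tau> W" "x \<in> W"
  shows "\<tau> x \<notin> W"
  using assms by (auto simp: slice_def disjnt_iff)

lemma sliceI:
  assumes "openin M W" "\<And>x. x \<in> W \<Longrightarrow> \<tau> x \<notin> W"
  shows "slice M \<tau> W"
  using assms by (auto simp: slice_def disjnt_iff)

lemma openin_orbit_map_image:
  assumes inv: "free_involution M \<tau>" and W: "openin M W"
  shows "openin (orbit_space M \<tau>) (orbit_map \<tau> ` W)"
  unfolding openin_orbit_space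
proof
  have sub: "W \<subseteq> topspace M"
    using W by (rule openin_subset)
  then show "orbit_map \<tau> ` W \<subseteq> orbit_map \<tau> ` topspace M"
    by blast
  have "orbit_map \<tau> x \<in> orbit_map \<tau> ` W \<longleftrightarrow> x \<in> W \<or> \<tau> x \<in> W" if "x \<in> topspace M" for x
    using orbit_map_eq_iff[OF inv that] orbit_map_involution[OF inv that] by (auto simp: image_iff)
  then have "{x \<in> topspace M. orbit_map \<tau> x \<in> orbit_map \<tau> ` W} = W \<union> {x \<in> topspace M. \<tau> x \<in> W}"
    using sub by auto
  moreover have "openin M {x \<in> topspace M. \<tau> x \<in> W}"
    using inv W openin_continuous_map_preimage unfolding free_involution_def by blast
  ultimately show "openin M {x \<in> topspace M. orbit_map \<tau> x \<in> orbit_map \<tau> ` W}"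
    using W by auto
qed

lemma slice_imp_local_section:
  assumes inv: "free_involution M \<tau>" and W: "slice M \<tau> W"
  shows "has_local_section M (orbit_space M \<tau>) (orbit_map \<tau>) (orbit_map \<tau> ` W)"
proof -
  let ?q = "orbit_map \<tau>" and ?s = "inv_into W (orbit_map \<tau>)"
  have oW: "openin M W" and sub: "W \<subseteq> topspace M"
    using W openin_subset by (auto simp: slice_def)
  have inj: "inj_on ?q W"
  proof (rule inj_onI)
    fix x y assume "x \<in> W" "y \<in> W" "?q x = ?q y"
    then show "x = y"
      using orbit_map_eq_iff[OF inv, of x y] slice_not_both[OF W] sub by auto
  qed
  have "continuous_map (subtopology (orbit_space M \<tau>) (?q ` W)) M ?s"
    unfolding continuous_map_def
  proof (intro conjI allI impI)
    show "?s \<in> topspace (subtopology (orbit_space M \<tau>) (?q ` W)) \<rightarrow> topspace M"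
      using sub inv_into_into[of _ ?q W] by auto
  next
    fix V assume V: "openin M V"
    have "{y \<in> topspace (subtopology (orbit_space M \<tau>) (?q ` W)). ?s y \<in> V} = ?q ` (W \<inter> V)"
      using sub inj by (auto simp: topspace_orbit_space)
    moreover have "openin (orbit_space M \<tau>) (?q ` (W \<inter> V))"
      using openin_orbit_map_image[OF inv] oW V by blast
    ultimately show "openin (subtopology (orbit_space M \<tau>) (?q ` W))
        {y \<in> topspace (subtopology (orbit_space M \<tau>) (?q ` W)). ?s y \<in> V}"
      by (metis Int_lower1 image_mono openin_open_subtopology openin_orbit_map_image[OF inv oW])
  qed
  moreover have "?q (?s y) = y" if "y \<in> ?q ` W" for y
    using that by (rule f_inv_into_f)
  ultimately show ?thesis
    unfolding has_local_section_def by blast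
qed

text \<open>The slice consists of the values of the section \<open>s\<close>, that is, of the points \<open>x\<close>
  fixed by \<open>s \<circ> q\<close>. To see that it is open, let \<open>N\<close> be a neighbourhood of such an
  \<open>x\<close> that is disjoint from \<open>\<tau> N\<close>, which exists in a Hausdorff space. If \<open>y\<close>
  and \<open>s (q y)\<close> both lie in \<open>N\<close>, then \<open>s (q y)\<close> is \<open>y\<close> and not
  \<open>\<tau> y\<close>; by continuity this covers all \<open>y\<close> near \<open>x\<close>.\<close>

lemma local_section_imp_slice:
  assumes inv: "free_involution M \<tau>" and haus: "Hausdorff_space M"
    and U: "openin (orbit_space M \<tau>) U"
    and sec: "has_local_section M (orbit_space M \<tau>) (orbit_map \<tau>) U"
  shows "\<exists>W. slice M \<tau> W \<and> (\<forall>x\<in>topspace M. orbit_map \<tau> x \<in> U \<longrightarrow> x \<in> W \<or> \<tau> x \<in> W)"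
proof -
  let ?q = "orbit_map \<tau>"
  let ?V = "{x \<in> topspace M. ?q x \<in> U}"
  obtain s where s: "continuous_map (subtopology (orbit_space M \<tau>) U) M s"
    and qs: "\<And>y. y \<in> U \<Longrightarrow> ?q (s y) = y"
    using sec by (auto simp: has_local_section_def)
  have V: "openin M ?V"
    using U by (simp add: openin_orbit_space)
  have "continuous_map M (orbit_space M \<tau>) ?q"
    using quotient_map_orbit_map quotient_imp_continuous_map by blast
  then have "continuous_map (subtopology M ?V) (subtopology (orbit_space M \<tau>) U) ?q"
    by (auto simp: continuous_map_in_subtopology continuous_map_from_subtopology)
  then have sq: "continuous_map (subtopology M ?V) M (s \<circ> ?q)"
    using s continuous_map_compose by blast
  have s_cases: "s (?q x) = x \<or> s (?q x) = \<tau> x" if "x \<in> ?V" for x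
    using qs[of "?q x"] that orbit_map_eq_iff[OF inv, of x "s (?q x)"] by auto
  note q\<tau> = orbit_map_involution[OF inv]
  let ?W = "{x \<in> ?V. s (?q x) = x}"
  have "openin M ?W"
  proof (subst openin_subopen, intro ballI)
    fix x assume x: "x \<in> ?W"
    have xM: "x \<in> topspace M" and xV: "x \<in> ?V"
      using x by auto
    obtain N N' where N: "openin M N" "openin M N'" "x \<in> N" "\<tau> x \<in> N'" "disjnt N N'"
      using haus xM free_involutionD[OF inv xM] unfolding Hausdorff_space_def by metis
    let ?N = "N \<inter> {y \<in> topspace M. \<tau> y \<in> N'}"
    have N0: "openin M ?N"
      using N inv openin_continuous_map_preimage[of M M \<tau> N'] by (auto simp: free_involution_def)
    let ?T = "{y \<in> topspace (subtopology M ?V). (s \<circ> ?q) y \<in> ?N} \<inter> ?N"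
    have "openin (subtopology M ?V) {y \<in> topspace (subtopology M ?V). (s \<circ> ?q) y \<in> ?N}"
      using openin_continuous_map_preimage[OF sq N0] .
    then have T: "openin M ?T"
      using V N0 by (meson openin_Int openin_open_subtopology)
    have "?T \<subseteq> ?W"
    proof
      fix y assume y: "y \<in> ?T"
      then have "\<tau> y \<notin> N" "s (?q y) \<in> N" "y \<in> ?V"
        using N(5) by (auto simp: disjnt_iff)
      then show "y \<in> ?W"
        using s_cases by force
    qed
    moreover have "x \<in> ?T"
      using x N xM by auto
    ultimately show "\<exists>T. openin M T \<and> x \<in> T \<and> T \<subseteq> ?W"
      using T by blast
  qed
  moreover have "\<tau> x \<notin> ?W" if "x \<in> ?W" for x
    using that q\<tau>[of x] free_involutionD(3)[OF inv, of x] by force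
  ultimately have "slice M \<tau> ?W"
    using sliceI by blast
  moreover have "x \<in> ?W \<or> \<tau> x \<in> ?W" if "x \<in> topspace M" "?q x \<in> U" for x
    using that s_cases[of x] q\<tau>[of x] free_involutionD[OF inv, of x] by auto
  ultimately show ?thesis
    by blast
qed

lemma Inf_enat_le_iff: "Inf A \<le> enat n \<longleftrightarrow> (\<exists>a\<in>A. a \<le> enat n)" for A :: "enat set"
proof
  assume le: "Inf A \<le> enat n"
  then have "A \<noteq> {}"
    by (auto simp: top_enat_def)
  then have "Inf A \<in> A"
    by (simp add: Inf_enat_def) (metis LeastI ex_in_conv)
  then show "\<exists>a\<in>A. a \<le> enat n"
    using le by blast
qed (meson Inf_lower order_trans)

text \<open>In a slice cover repetitions and empty members are harmless, so that a cover of the orbit space by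
  fewer than \<open>n + 1\<close> sets can be padded with empty slices.\<close>

lemma secat_le_iff_slice_cover:
  assumes inv: "free_involution M \<tau>" and haus: "Hausdorff_space M"
  shows "secat M (orbit_space M \<tau>) (orbit_map \<tau>) \<le> enat (Suc n) \<longleftrightarrow> (\<exists>W. slice_cover M \<tau> n W)"
proof
  assume "secat M (orbit_space M \<tau>) (orbit_map \<tau>) \<le> enat (Suc n)"
  then obtain \<U> where \<U>: "finite \<U>" "card \<U> \<le> Suc n" "\<Union>\<U> = topspace (orbit_space M \<tau>)"
    and sec: "\<And>U. U \<in> \<U> \<Longrightarrow> openin (orbit_space M \<tau>) U \<and>
      has_local_section M (orbit_space M \<tau>) (orbit_map \<tau>) U"
    unfolding secat_def Inf_enat_le_iff by auto
  obtain S where S: "\<And>U. U \<in> \<U> \<Longrightarrow> slice M \<tau> (S U) \<and>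
      (\<forall>x\<in>topspace M. orbit_map \<tau> x \<in> U \<longrightarrow> x \<in> S U \<or> \<tau> x \<in> S U)"
    using local_section_imp_slice[OF inv haus] sec by metis
  obtain b where b: "bij_betw b {0..<card \<U>} \<U>"
    using ex_bij_betw_nat_finite[OF \<U>(1)] by blast
  define W where "W i = (if i < card \<U> then S (b i) else {})" for i
  have "slice M \<tau> (W i)" for i
    using S[of "b i"] bij_betwE[OF b] by (auto simp: W_def slice_def)
  moreover have "\<exists>i\<le>n. x \<in> W i \<or> \<tau> x \<in> W i" if x: "x \<in> topspace M" for x
  proof -
    have "orbit_map \<tau> x \<in> \<Union>\<U>"
      using x \<U>(3) by (simp add: topspace_orbit_space)
    then obtain U where U: "U \<in> \<U>" "orbit_map \<tau> x \<in> U"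
      by blast
    then obtain i where i: "i < card \<U>" "b i = U"
      using b by (metis atLeastLessThan_iff bij_betw_iff_bijections)
    then show ?thesis
      using S[OF U(1)] U(2) x \<U>(2) by (intro exI[of _ i]) (auto simp: W_def)
  qed
  ultimately show "\<exists>W. slice_cover M \<tau> n W"
    unfolding slice_cover_def by blast
next
  assume "\<exists>W. slice_cover M \<tau> n W"
  then obtain W where W: "\<And>i. i \<le> n \<Longrightarrow> slice M \<tau> (W i)"
    and cover: "\<And>x. x \<in> topspace M \<Longrightarrow> \<exists>i\<le>n. x \<in> W i \<or> \<tau> x \<in> W i"
    by (auto simp: slice_cover_def)
  let ?\<U> = "(\<lambda>i. orbit_map \<tau> ` W i) ` {..n}"
  have opn: "openin (orbit_space M \<tau>) U \<and> has_local_section M (orbit_space M \<tau>) (orbit_map \<tau>) U"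
    if "U \<in> ?\<U>" for U
    using that W openin_orbit_map_image[OF inv] slice_imp_local_section[OF inv]
    by (auto simp: slice_def)
  have "topspace (orbit_space M \<tau>) \<subseteq> \<Union>?\<U>"
  proof
    fix y assume "y \<in> topspace (orbit_space M \<tau>)"
    then obtain x where x: "x \<in> topspace M" "y = orbit_map \<tau> x"
      by (auto simp: topspace_orbit_space)
    then obtain i where "i \<le> n" "x \<in> W i \<or> \<tau> x \<in> W i"
      using cover by blast
    moreover have "orbit_map \<tau> (\<tau> x) = y"
      using x orbit_map_eq_iff[OF inv x(1), of "\<tau> x"] by simp
    ultimately show "y \<in> \<Union>?\<U>"
      using x(2) by (auto simp: image_iff)
  qed
  then have "\<Union>?\<U> = topspace (orbit_space M \<tau>)"
    using opn openin_subset by blast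
  then have "enat (card ?\<U>) \<in> {enat (card \<U>) | \<U>. finite \<U> \<and> \<Union>\<U> = topspace (orbit_space M \<tau>) \<and>
      (\<forall>U\<in>\<U>. openin (orbit_space M \<tau>) U \<and>
        has_local_section M (orbit_space M \<tau>) (orbit_map \<tau>) U)}"
    using opn by blast
  moreover have "card ?\<U> \<le> Suc n"
    using card_image_le[of "{..n}" "\<lambda>i. orbit_map \<tau> ` W i"] by simp
  ultimately show "secat M (orbit_space M \<tau>) (orbit_map \<tau>) \<le> enat (Suc n)"
    unfolding secat_def Inf_enat_le_iff by (metis (no_types, lifting) enat_ord_simps(1))
qed

section \<open>Slice covers and equivariant maps to spheres\<close>

text \<open>A map to a sphere of smaller dimension \<open>k\<close> is covered as well: its coordinates beyond
  \<open>k\<close> vanish and give empty slices.\<close>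

lemma nsphere_map_imp_slice_cover:
  assumes inv: "free_involution M \<tau>" and f: "continuous_map M (nsphere k) f"
    and odd: "\<And>x. x \<in> topspace M \<Longrightarrow> f (\<tau> x) = (\<lambda>i. - f x i)" and "k \<le> n"
  shows "\<exists>W. slice_cover M \<tau> n W"
proof -
  have coord: "continuous_map M euclideanreal (\<lambda>x. f x i)" for i
    using f by (simp add: nsphere continuous_map_in_subtopology continuous_map_componentwise_UNIV)
  have sph: "(\<Sum>i\<le>k. (f x i)\<^sup>2) = 1" if "x \<in> topspace M" for x
    using f that by (auto simp: nsphere continuous_map_in_subtopology)
  define W where "W i = {x \<in> topspace M. f x i \<in> {0<..}}" for i
  have "slice M \<tau> (W i)" for i
  proof (rule sliceI)
    show "openin M (W i)"
      unfolding W_def by (rule openin_continuous_map_preimage[OF coord]) simp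
    show "\<tau> x \<notin> W i" if "x \<in> W i" for x
      using that odd[of x] by (auto simp: W_def)
  qed
  moreover have "\<exists>i\<le>n. x \<in> W i \<or> \<tau> x \<in> W i" if x: "x \<in> topspace M" for x
  proof -
    have "\<exists>i\<le>k. f x i \<noteq> 0"
      using sph[OF x] by (rule contrapos_pp) simp
    then obtain i where "i \<le> k" "f x i \<noteq> 0"
      by blast
    then show ?thesis
      using x free_involutionD[OF inv x] odd[OF x] \<open>k \<le> n\<close>
      by (intro exI[of _ i]) (auto simp: W_def)
  qed
  ultimately show ?thesis
    unfolding slice_cover_def by blast
qed

text \<open>The statement about an arbitrary closed set \<open>S\<close> makes the induction work. The part of \<open>S\<close>
  covered by \<open>V k\<close> alone is closed, so normality puts an open set \<open>G\<close> between it and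
  \<open>V k\<close>; the induction hypothesis then applies to \<open>S - G\<close>.\<close>

lemma normal_space_shrink_finite_cover:
  assumes "normal_space X" "finite I" "closedin X S"
    and "\<And>i. i \<in> I \<Longrightarrow> openin X (V i)" "S \<subseteq> (\<Union>i\<in>I. V i)"
  shows "\<exists>C. (\<forall>i\<in>I. closedin X (C i) \<and> C i \<subseteq> V i) \<and> S \<subseteq> (\<Union>i\<in>I. C i)"
  using assms(2-)
proof (induction I arbitrary: S rule: finite_induct)
  case (insert k I)
  let ?K = "S - (\<Union>i\<in>I. V i)"
  have "closedin X ?K"
    using insert.prems by (intro closedin_diff openin_Union) auto
  moreover have "openin X (V k)" "?K \<subseteq> V k"
    using insert.prems by auto
  ultimately obtain G where G: "openin X G" "?K \<subseteq> G" "X closure_of G \<subseteq> V k"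
    using assms(1)[unfolded normal_space_alt, rule_format, of ?K "V k"] by blast
  have "\<exists>C. (\<forall>i\<in>I. closedin X (C i) \<and> C i \<subseteq> V i) \<and> S - G \<subseteq> (\<Union>i\<in>I. C i)"
  proof (rule insert.IH)
    show "closedin X (S - G)"
      using insert.prems(1) G(1) by (rule closedin_diff)
    show "S - G \<subseteq> (\<Union>i\<in>I. V i)"
      using G(2) by blast
  qed (use insert.prems(2) in simp)
  then obtain C where "(\<forall>i\<in>I. closedin X (C i) \<and> C i \<subseteq> V i) \<and> S - G \<subseteq> (\<Union>i\<in>I. C i)" ..
  then have C: "\<And>i. i \<in> I \<Longrightarrow> closedin X (C i) \<and> C i \<subseteq> V i" "S - G \<subseteq> (\<Union>i\<in>I. C i)"
    by auto
  have "G \<subseteq> X closure_of G"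
    using closure_of_subset[OF openin_subset[OF G(1)]] .
  then have "S \<subseteq> X closure_of G \<union> (\<Union>i\<in>I. C i)"
    using C(2) by blast
  then have "(\<forall>i\<in>insert k I. closedin X ((C(k := X closure_of G)) i) \<and> (C(k := X closure_of G)) i \<subseteq> V i)
      \<and> S \<subseteq> (\<Union>i\<in>insert k I. (C(k := X closure_of G)) i)"
    using C(1) G(3) insert.hyps(2) by auto
  then show ?case
    by blast
qed auto

text \<open>Let \<open>K\<close> consist of the points of \<open>C\<close> in \<open>W\<close> and the mirror images of the
  remaining points of \<open>C\<close>. If \<open>g\<close> is \<open>1\<close> on \<open>K\<close> and vanishes
  outside \<open>W\<close>, then \<open>g - g \<circ> \<tau>\<close> is odd and takes the value \<open>1\<close> or
  \<open>-1\<close> at each point of \<open>C\<close>.\<close>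

lemma odd_function_on_slice:
  assumes inv: "free_involution M \<tau>" and normal: "normal_space M" and W: "slice M \<tau> W"
    and C: "closedin M C" "\<And>x. x \<in> C \<Longrightarrow> x \<in> W \<or> \<tau> x \<in> W"
  obtains h where "continuous_map M euclideanreal h"
    "\<And>x. x \<in> topspace M \<Longrightarrow> h (\<tau> x) = - h x" "\<And>x. x \<in> C \<Longrightarrow> h x \<noteq> (0::real)"
proof -
  have \<tau>: "continuous_map M M \<tau>"
    using inv by (simp add: free_involution_def)
  have oW: "openin M W" and sub: "W \<subseteq> topspace M"
    using W openin_subset by (auto simp: slice_def)
  let ?\<tau>W = "{x \<in> topspace M. \<tau> x \<in> W}"
  \<comment> \<open>Removing the open set \<open>?\<tau>W\<close> from \<open>C\<close>, instead of intersecting with \<open>W\<close>, shows that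
    \<open>?K\<close> is closed.\<close>
  let ?K = "(C - ?\<tau>W) \<union> {x \<in> topspace M. \<tau> x \<in> C - W}"
  have "openin M ?\<tau>W"
    using openin_continuous_map_preimage[OF \<tau> oW] .
  then have "closedin M (C - ?\<tau>W)"
    using C(1) by blast
  moreover have "closedin M {x \<in> topspace M. \<tau> x \<in> C - W}"
    using C(1) oW by (intro closedin_continuous_map_preimage[OF \<tau>]) blast
  ultimately have K: "closedin M ?K"
    by (rule closedin_Un)
  have CM: "C \<subseteq> topspace M"
    using C(1) by (rule closedin_subset)
  have KW: "?K \<subseteq> W"
    using C(2) CM free_involutionD[OF inv] by fastforce
  then have disj: "disjnt ?K (topspace M - W)"
    by (auto simp: disjnt_iff)
  have "closedin M (topspace M - W)"
    using oW by blast
  then obtain g where g: "continuous_map M euclideanreal g" "g ` ?K \<subseteq> {1}" "g ` (topspace M - W) \<subseteq> {0}"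
    by (rule Urysohn_lemma_alt[OF normal K _ disj])
  have on_K: "g x = 1 \<and> g (\<tau> x) = 0" if "x \<in> ?K" for x
  proof -
    have "x \<in> W"
      using KW that by blast
    then have "\<tau> x \<in> topspace M - W"
      using sub slice_not_both[OF W] free_involutionD[OF inv] by blast
    then show ?thesis
      using g that by blast
  qed
  show ?thesis
  proof
    show "continuous_map M euclideanreal (\<lambda>x. g x - g (\<tau> x))"
      using g(1) continuous_map_compose[OF \<tau> g(1)] by (auto simp: o_def intro: continuous_map_diff)
    show "g (\<tau> x) - g (\<tau> (\<tau> x)) = - (g x - g (\<tau> x))" if "x \<in> topspace M" for x
      using free_involutionD[OF inv that] by simp
    show "g x - g (\<tau> x) \<noteq> 0" if x: "x \<in> C" for x
    proof (cases "x \<in> W")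
      case True
      then have "x \<in> ?K"
        using x slice_not_both[OF W] by blast
      then show ?thesis
        using on_K by simp
    next
      case False
      have "x \<in> topspace M"
        using x CM by blast
      then have "\<tau> x \<in> ?K" "\<tau> (\<tau> x) = x"
        using x False free_involutionD[OF inv] by auto
      then show ?thesis
        using on_K[of "\<tau> x"] by simp
    qed
  qed
qed

text \<open>The odd functions belonging to the slices have no common zero, because the closed sets on which they
  are nonzero cover \<open>M\<close>. Dividing by the norm gives the map to the sphere.\<close>

lemma slice_cover_imp_nsphere_map:
  assumes inv: "free_involution M \<tau>" and normal: "normal_space M" and W: "slice_cover M \<tau> n W"
  shows "\<exists>f. continuous_map M (nsphere n) f \<and> (\<forall>x\<in>topspace M. f (\<tau> x) = (\<lambda>i. - f x i))"
proof -
  have \<tau>: "continuous_map M M \<tau>"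
    using inv by (simp add: free_involution_def)
  have slice: "slice M \<tau> (W i)" if "i \<le> n" for i
    using W that by (simp add: slice_cover_def)
  let ?V = "\<lambda>i. W i \<union> {x \<in> topspace M. \<tau> x \<in> W i}"
  have "\<exists>C. (\<forall>i\<in>{..n}. closedin M (C i) \<and> C i \<subseteq> ?V i) \<and> topspace M \<subseteq> (\<Union>i\<in>{..n}. C i)"
  proof (rule normal_space_shrink_finite_cover[OF normal])
    show "openin M (?V i)" if "i \<in> {..n}" for i
      using slice[of i] that openin_continuous_map_preimage[OF \<tau>]
      by (auto simp: slice_def)
    show "topspace M \<subseteq> (\<Union>i\<in>{..n}. ?V i)"
      using W by (fastforce simp: slice_cover_def)
  qed auto
  then obtain C where C: "\<And>i. i \<le> n \<Longrightarrow> closedin M (C i) \<and> C i \<subseteq> ?V i"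
    and cover: "topspace M \<subseteq> (\<Union>i\<le>n. C i)"
    by auto
  have "\<exists>h. continuous_map M euclideanreal h \<and> (\<forall>x\<in>topspace M. h (\<tau> x) = - h x) \<and>
      (\<forall>x\<in>C i. h x \<noteq> 0)" if "i \<le> n" for i
  proof -
    have "closedin M (C i)" "\<And>x. x \<in> C i \<Longrightarrow> x \<in> W i \<or> \<tau> x \<in> W i"
      using C[OF that] by auto
    from odd_function_on_slice[OF inv normal slice[OF that] this] show ?thesis
      by metis
  qed
  then obtain h where h: "\<And>i. i \<le> n \<Longrightarrow> continuous_map M euclideanreal (h i)"
    and odd: "\<And>i x. i \<le> n \<Longrightarrow> x \<in> topspace M \<Longrightarrow> h i (\<tau> x) = - h i x"
    and nz: "\<And>i x. i \<le> n \<Longrightarrow> x \<in> C i \<Longrightarrow> h i x \<noteq> 0"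
    by metis
  define N where "N x = (\<Sum>i\<le>n. (h i x)\<^sup>2)" for x
  have N: "N x > 0" if x: "x \<in> topspace M" for x
  proof -
    obtain i where "i \<le> n" "x \<in> C i"
      using cover x by blast
    then show ?thesis
      unfolding N_def using nz by (intro sum_pos2[of _ i]) auto
  qed
  have N\<tau>: "N (\<tau> x) = N x" if "x \<in> topspace M" for x
    unfolding N_def using odd that by (intro sum.cong) auto
  have contN: "continuous_map M euclideanreal N"
    unfolding N_def using h by (intro continuous_map_sum continuous_map_real_pow) auto
  define f where "f x = (\<lambda>i. if i < Suc n then h i x / sqrt (N x) else 0)" for x
  have "continuous_map M euclideanreal (\<lambda>x. h i x / sqrt (N x))" if "i \<le> n" for i
    using h[OF that] contN N by (intro continuous_map_real_divide continuous_map_sqrt) (auto simp: less_le)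
  then have "continuous_map M (Euclidean_space (Suc n)) f"
    unfolding f_def continuous_map_componentwise_Euclidean_space by (simp add: less_Suc_eq_le)
  moreover have "(\<Sum>i\<le>n. (f x i)\<^sup>2) = 1" if x: "x \<in> topspace M" for x
  proof -
    have "(\<Sum>i\<le>n. (f x i)\<^sup>2) = (\<Sum>i\<le>n. (h i x)\<^sup>2 / N x)"
      using N[OF x] by (intro sum.cong) (auto simp: f_def power_divide)
    also have "\<dots> = N x / N x"
      unfolding N_def by (rule sum_divide_distrib[symmetric])
    finally show ?thesis
      using N[OF x] by simp
  qed
  ultimately have "continuous_map M (nsphere n) f"
    by (auto simp: nsphere_def continuous_map_in_subtopology)
  moreover have "f (\<tau> x) = (\<lambda>i. - f x i)" if "x \<in> topspace M" for x
    using odd N\<tau> that by (auto simp: f_def)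
  ultimately show ?thesis
    by blast
qed

lemma involution_index_le_iff_slice_cover:
  assumes "free_involution M \<tau>" "normal_space M"
  shows "involution_index M \<tau> \<le> enat n \<longleftrightarrow> (\<exists>W. slice_cover M \<tau> n W)"
proof
  assume "involution_index M \<tau> \<le> enat n"
  then obtain k f where "k \<le> n" "continuous_map M (nsphere k) f"
    "\<forall>x\<in>topspace M. f (\<tau> x) = (\<lambda>i. - f x i)"
    unfolding involution_index_def Inf_enat_le_iff by auto
  then show "\<exists>W. slice_cover M \<tau> n W"
    using nsphere_map_imp_slice_cover[OF assms(1)] by blast
next
  assume "\<exists>W. slice_cover M \<tau> n W"
  then have "\<exists>f. continuous_map M (nsphere n) f \<and> (\<forall>x\<in>topspace M. f (\<tau> x) = (\<lambda>i. - f x i))"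
    using slice_cover_imp_nsphere_map[OF assms] by blast
  then show "involution_index M \<tau> \<le> enat n"
    unfolding involution_index_def by (intro Inf_lower) blast
qed

section \<open>Index and sectional category\<close>

theorem secat_le_iff_involution_index_le:
  assumes "free_involution M \<tau>" "Hausdorff_space M" "normal_space M"
  shows "secat M (orbit_space M \<tau>) (orbit_map \<tau>) \<le> enat (Suc n) \<longleftrightarrow> involution_index M \<tau> \<le> enat n"
  by (simp add: assms secat_le_iff_slice_cover involution_index_le_iff_slice_cover)

text \<open>The empty family covers only the empty space.\<close>

lemma secat_nonzero:
  assumes "topspace Y \<noteq> {}"
  shows "secat X Y q \<noteq> 0"
proof
  assume "secat X Y q = 0"
  then have "secat X Y q \<le> enat 0"
    by (simp add: zero_enat_def)
  then obtain \<U> where "finite \<U>" "card \<U> = 0" "\<Union>\<U> = topspace Y"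
    unfolding secat_def Inf_enat_le_iff by auto
  then show False
    using assms by simp
qed

theorem proposition3p36:
  fixes M :: "'a topology" and E :: "nat \<Rightarrow> 'a set set" and \<tau> :: "'a \<Rightarrow> 'a" and m :: nat
  assumes "cw_complex M E"
    and "has_cw_dimension E m"
    and "connected_space M"
    and "free_involution M \<tau>"
    and "cellular_map M E M E \<tau>"
    and "secat M (orbit_space M \<tau>) (orbit_map \<tau>) = enat m"
  shows "involution_index M \<tau> = enat (m - 1)"
proof -
  have haus: "Hausdorff_space M"
    using assms(1) by (simp add: cw_complex_def)
  note iff = secat_le_iff_involution_index_le[OF assms(4) haus normal_space_cw_complex[OF assms(1)],
      unfolded assms(6)]
  obtain e where e: "e \<in> E m"
    using assms(2) by (auto simp: has_cw_dimension_def)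
  then have "\<exists>\<phi>. characteristic_map M E m e \<phi>"
    using assms(1) by (simp add: cw_complex_def)
  then obtain \<phi> where "characteristic_map M E m e \<phi>" ..
  then have "e \<noteq> {}"
    using characteristic_map_interior(1)[OF _ cell_subset_topspace[OF assms(1) e]] disc_interior_nonempty
    by blast
  then have "topspace (orbit_space M \<tau>) \<noteq> {}"
    using cell_subset_topspace[OF assms(1) e] by (auto simp: topspace_orbit_space)
  then have "m \<noteq> 0"
    using secat_nonzero assms(6) by (metis zero_enat_def)
  then obtain n where m: "m = Suc n"
    using not0_implies_Suc by blast
  have le: "involution_index M \<tau> \<le> enat n"
    using iff[of n] m by simp
  then obtain k where k: "involution_index M \<tau> = enat k" "k \<le> n"
    by (cases "involution_index M \<tau>") auto
  then have "n \<le> k"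
    using iff[of k] m by simp
  then show ?thesis
    using k m by simp
qed

end
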